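(* Let $q$ be a prime power, $t$ a positive integer, and $\mathbb{V}$ an $r$-dimensional vector space over $\mathbb{F}_{q^t}$, with $\mathbb{P}=PG(\mathbb{V},\mathbb{F}_{q^t})=PG(r-1,q^t)$. Suppose $\mathbb{V}=V_1\oplus\cdots\oplus V_m$ (direct sum of $\mathbb{F}_{q^t}$-subspaces) with $\dim_{\mathbb{F}_{q^t}}V_i=s_i\geq 2$ for $i=1,\dots,m$. For each $i$, let $U_i$ be an $\mathbb{F}_q$-subspace of $V_i$ such that $L_{U_i}$ is a scattered $\mathbb{F}_q$-linear set of $PG(V_i,\mathbb{F}_{q^t})=PG(s_i-1,q^t)$. Let $W=U_1\oplus\cdots\oplus U_m$ (as $\mathbb{F}_q$-spaces). Then $L_W$ is a scattered $\mathbb{F}_q$-linear set of $\mathbb{P}$. Moreover, $L_W$ has rank $\frac{rt}{2}$ if and only if each $L_{U_i}$ has rank $\frac{s_it}{2}$.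
   Context: For an $\mathbb{F}_q$-subspace $U$ of an $\mathbb{F}_{q^t}$-vector space $V$ with $\dim_{\mathbb{F}_q}U=k$, $L_U=\{\langle u\rangle_{\mathbb{F}_{q^t}}: u\in U\setminus\{0\}\}$ is an $\mathbb{F}_q$-linear set of rank $k$ in $PG(V,\mathbb{F}_{q^t})$. The weight of a point $\langle v\rangle$ is $\dim_{\mathbb{F}_q}(U\cap\langle v\rangle_{\mathbb{F}_{q^t}})$; $L_U$ is scattered if all its points have weight $1$. It is known that a scattered $\mathbb{F}_q$-linear set in $PG(s-1,q^t)$ has rank at most $\frac{st}{2}$.
   Formalization: The "Moreover" equivalence is stated only for t ≥ 2; for t = 1 it is false (every subspace is scattered: s_1 = s_2 = 4 with U_1, U_2 of ranks 3 and 1 gives rank 4 = rt/2 for W). Scatteredness of L_W is proved for all t ≥ 1. *)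

theory Defs
  imports Complex_Main "HOL-Library.FuncSet" "HOL-Library.Cardinality"
    "HOL-Number_Theory.Prime_Powers"
begin

text \<open>The field extension is given by two field types and an embedding of the small field
  into the large one; the vector space is given by its scalar multiplication over the large field.\<close>

definition field_embedding :: "('k::field \<Rightarrow> 'f::field) \<Rightarrow> bool" where
  "field_embedding \<phi> \<longleftrightarrow>
     \<phi> 1 = 1 \<and> (\<forall>x y. \<phi> (x + y) = \<phi> x + \<phi> y) \<and> (\<forall>x y. \<phi> (x * y) = \<phi> x * \<phi> y)"

definition restrict_scalars ::
    "('k::field \<Rightarrow> 'f::field) \<Rightarrow> ('f \<Rightarrow> 'v::ab_group_add \<Rightarrow> 'v) \<Rightarrow> 'k \<Rightarrow> 'v \<Rightarrow> 'v" where
  "restrict_scalars \<phi> scale = (\<lambda>c v. scale (\<phi> c) v)"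

text \<open>Internal direct sum: every element of \<open>S\<close> is a sum of members of the \<open>A i\<close>
  in exactly one way, and all such sums lie in \<open>S\<close>.\<close>

definition internal_direct_sum :: "'i set \<Rightarrow> ('i \<Rightarrow> 'v::ab_group_add set) \<Rightarrow> 'v set \<Rightarrow> bool" where
  "internal_direct_sum I A S \<longleftrightarrow> bij_betw (\<lambda>u. \<Sum>i\<in>I. u i) (Pi\<^sub>E I A) S"

text \<open>A projective point is the one-dimensional subspace over the large field, as a set of vectors.\<close>

definition linear_set :: "('f::field \<Rightarrow> 'v::ab_group_add \<Rightarrow> 'v) \<Rightarrow> 'v set \<Rightarrow> 'v set set" where
  "linear_set scale U = {module.span scale {u} | u. u \<in> U - {0}}"

text \<open>Weight, rank and scatteredness refer to the subspace \<open>U\<close> defining the linear set,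
  since different \<open>U\<close> may define the same set of points.\<close>

definition point_weight ::
    "('k::field \<Rightarrow> 'f::field) \<Rightarrow> ('f \<Rightarrow> 'v::ab_group_add \<Rightarrow> 'v) \<Rightarrow> 'v set \<Rightarrow> 'v set \<Rightarrow> nat" where
  "point_weight \<phi> scale U P = vector_space.dim (restrict_scalars \<phi> scale) (U \<inter> P)"

definition linear_set_rank ::
    "('k::field \<Rightarrow> 'f::field) \<Rightarrow> ('f \<Rightarrow> 'v::ab_group_add \<Rightarrow> 'v) \<Rightarrow> 'v set \<Rightarrow> nat" where
  "linear_set_rank \<phi> scale U = vector_space.dim (restrict_scalars \<phi> scale) U"

definition scattered_linear_set ::
    "('k::field \<Rightarrow> 'f::field) \<Rightarrow> ('f \<Rightarrow> 'v::ab_group_add \<Rightarrow> 'v) \<Rightarrow> 'v set \<Rightarrow> 'v set \<Rightarrow> bool" where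
  "scattered_linear_set \<phi> scale V U \<longleftrightarrow>
     module.subspace (restrict_scalars \<phi> scale) U \<and> U \<subseteq> V \<and>
     (\<forall>P \<in> linear_set scale U. point_weight \<phi> scale U P = 1)"

end

theory Submission
  imports Defs
begin

text \<open>
  If \<open>\<lambda> w \<in> W\<close>, comparing components in \<open>V\<^sub>i\<close> gives \<open>\<lambda> u\<^sub>i \<in> U\<^sub>i\<close>, so \<open>\<lambda>\<close> lies in the small
  field as soon as some \<open>u\<^sub>i\<close> is nonzero; hence \<open>W\<close> is scattered. Ranks and dimensions are additive,
  so the equivalence follows from the bound \<open>2k \<le> st\<close> for a scattered \<open>U\<close> of rank \<open>k\<close> inside an
  \<open>s\<close>-dimensional space (\<open>t \<ge> 2\<close>).

  For that bound put \<open>Q = q\<^sup>t\<close>, \<open>K = q\<^sup>k\<close> and \<open>x\<^sub>f = |U \<inter> ker f|\<close> for a linear functional \<open>f\<close>. Since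
  \<open>x\<^sub>f\<close> is a power of \<open>q\<close>, it never lies strictly between the consecutive powers \<open>K/Q\<close> and \<open>qK/Q\<close>, so
  \<open>(x\<^sub>f - K/Q)(x\<^sub>f - qK/Q) \<ge> 0\<close>. Scatteredness determines the first two moments of \<open>x\<^sub>f\<close>, and the mean of
  this product over all functionals is exactly \<open>(1 - 1/Q)(1 - q/Q)\<close>. The functionals vanishing on the
  \<open>s\<close>-dimensional space have proportion \<open>Q\<^sup>-\<^sup>s\<close> and alone contribute \<open>Q\<^sup>-\<^sup>s K\<^sup>2 (1 - 1/Q)(1 - q/Q)\<close>,
  whence \<open>K\<^sup>2 \<le> Q\<^sup>s\<close>.
\<close>

section \<open>Counting vectors over a finite field\<close>

context vector_space
begin

text \<open>Coefficient families are taken extensional on \<open>B\<close>, so that each vector of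
  the span has just one; the span can then be counted as a function space.\<close>

lemma bij_betw_linear_combinations:
  assumes "finite B" and "independent B"
  shows "bij_betw (\<lambda>c. \<Sum>b\<in>B. c b *s b) (B \<rightarrow>\<^sub>E UNIV) (span B)"
  unfolding bij_betw_def
proof
  show "inj_on (\<lambda>c. \<Sum>b\<in>B. c b *s b) (B \<rightarrow>\<^sub>E UNIV)"
  proof (rule inj_onI)
    fix c d assume c: "c \<in> B \<rightarrow>\<^sub>E UNIV" and d: "d \<in> B \<rightarrow>\<^sub>E UNIV"
      and eq: "(\<Sum>b\<in>B. c b *s b) = (\<Sum>b\<in>B. d b *s b)"
    have "(\<Sum>b\<in>B. (c b - d b) *s b) = 0"
      using eq by (simp add: scale_left_diff_distrib sum_subtractf)
    then have "c b - d b = 0" if "b \<in> B" for b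
      using independentD[OF assms(2,1) subset_refl, of "\<lambda>b. c b - d b"] that by blast
    then show "c = d" using c d by (auto intro: PiE_ext)
  qed
  show "(\<lambda>c. \<Sum>b\<in>B. c b *s b) ` (B \<rightarrow>\<^sub>E UNIV) = span B"
  proof
    show "(\<lambda>c. \<Sum>b\<in>B. c b *s b) ` (B \<rightarrow>\<^sub>E UNIV) \<subseteq> span B"
      by (auto intro: span_sum span_scale span_base)
    show "span B \<subseteq> (\<lambda>c. \<Sum>b\<in>B. c b *s b) ` (B \<rightarrow>\<^sub>E UNIV)"
    proof
      fix x assume "x \<in> span B"
      then obtain c where "x = (\<Sum>b\<in>B. c b *s b)"
        using span_finite[OF assms(1)] by auto
      then have "x = (\<Sum>b\<in>B. restrict c B b *s b)" by simp
      then show "x \<in> (\<lambda>c. \<Sum>b\<in>B. c b *s b) ` (B \<rightarrow>\<^sub>E UNIV)"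
        by (rule image_eqI[of _ _ "restrict c B"]) auto
    qed
  qed
qed

lemma card_span_independent:
  assumes "finite B" and "independent B"
  shows "card (span B) = CARD('a) ^ card B"
  using bij_betw_same_card[OF bij_betw_linear_combinations[OF assms]] assms(1)
  by (simp add: card_funcsetE)

lemma finite_span:
  assumes "finite (UNIV :: 'a set)" and "finite B" and "independent B"
  shows "finite (span B)"
  using bij_betw_finite[OF bij_betw_linear_combinations[OF assms(2,3)]] assms(1,2)
  by (simp add: finite_PiE)

lemma card_subspace:
  assumes "subspace S" and "finite S"
  shows "card S = CARD('a) ^ dim S"
proof -
  obtain B where B: "B \<subseteq> S" "independent B" "S \<subseteq> span B" "card B = dim S"
    by (rule basis_exists)
  then have "span B = S" using assms(1) by (simp add: span_subspace)
  then show ?thesis using card_span_independent[of B] B assms(2) finite_subset by metis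
qed

text \<open>An infinite basis would have \<open>card\<close> 0, so a positive \<open>dim\<close>
  rules it out. This is how a dimension at least 2 makes each summand finite in the end.\<close>

lemma finite_subspace_of_dim_pos:
  assumes "finite (UNIV :: 'a set)" and "subspace S" and "dim S > 0"
  shows "finite S"
proof -
  obtain B where B: "B \<subseteq> S" "independent B" "S \<subseteq> span B" "card B = dim S"
    by (rule basis_exists)
  then have "finite B" using assms(3) by (metis card.infinite less_irrefl)
  then show ?thesis using finite_span[OF assms(1) _ B(2)] B(3) finite_subset by blast
qed

section \<open>Linear functionals vanishing on a set\<close>

definition annihilator :: "'b set \<Rightarrow> ('b \<Rightarrow> 'a) set" where
  "annihilator S = {f. Vector_Spaces.linear scale (*) f \<and> (\<forall>x\<in>S. f x = 0)}"

end

context vector_space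
begin

lemma annihilator_span:
  "annihilator (span S) = annihilator S"
proof -
  interpret P: vector_space_pair scale "(*) :: 'a \<Rightarrow> 'a \<Rightarrow> 'a"
    by unfold_locales (simp_all add: algebra_simps)
  show ?thesis
    unfolding annihilator_def using P.linear_eq_0_on_span span_base by blast
qed

text \<open>\<open>annihilator {}\<close> is the whole dual space. In this form, counting an
  annihilator means counting the functionals with given zeros, as double counting requires.\<close>

lemma annihilator_eq: "annihilator S = {f \<in> annihilator {}. \<forall>x\<in>S. f x = 0}"
  by (auto simp: annihilator_def)

text \<open>Extend \<open>S\<close> to a basis \<open>B\<close>: a functional vanishing on
  \<open>S\<close> is determined by its values on \<open>B - S\<close>, and these are arbitrary. The
  product form avoids subtracting exponents.\<close>

lemma card_annihilator:
  assumes fin: "finite (UNIV :: 'b set)" and S: "independent S"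
  shows "CARD('a) ^ card S * card (annihilator S) = CARD('a) ^ dim (UNIV :: 'b set)"
proof -
  interpret P: vector_space_pair scale "(*) :: 'a \<Rightarrow> 'a \<Rightarrow> 'a"
    by unfold_locales (simp_all add: algebra_simps)
  define B where "B = extend_basis S"
  have SB: "S \<subseteq> B" and B: "independent B" and spanB: "span B = UNIV"
    unfolding B_def using extend_basis_superset independent_extend_basis span_extend_basis S by auto
  have finB: "finite B" using finite_subset[OF subset_UNIV fin] .
  have "bij_betw (\<lambda>f. restrict f (B - S)) (annihilator S) ((B - S) \<rightarrow>\<^sub>E UNIV)"
    unfolding bij_betw_def
  proof
    show "inj_on (\<lambda>f. restrict f (B - S)) (annihilator S)"
    proof (rule inj_onI)
      fix f g assume f: "f \<in> annihilator S" and g: "g \<in> annihilator S"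
        and eq: "restrict f (B - S) = restrict g (B - S)"
      have "f b = g b" if "b \<in> B" for b
        using f g fun_cong[OF eq, of b] that by (cases "b \<in> S") (auto simp: annihilator_def)
      then show "f = g"
        using f g P.linear_eq_on[of f g _ B] spanB by (auto simp: annihilator_def)
    qed
    show "(\<lambda>f. restrict f (B - S)) ` annihilator S = ((B - S) \<rightarrow>\<^sub>E UNIV)"
    proof
      show "(B - S) \<rightarrow>\<^sub>E UNIV \<subseteq> (\<lambda>f. restrict f (B - S)) ` annihilator S"
      proof
        fix g :: "'b \<Rightarrow> 'a" assume g: "g \<in> (B - S) \<rightarrow>\<^sub>E UNIV"
        define f where "f = P.construct B (\<lambda>b. if b \<in> S then 0 else g b)"
        have f: "f b = (if b \<in> S then 0 else g b)" if "b \<in> B" for b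
          unfolding f_def using P.construct_basis[OF B that] by simp
        have "f \<in> annihilator S"
          unfolding annihilator_def using P.linear_construct[OF B] f SB by (auto simp: f_def)
        moreover have "restrict f (B - S) = g"
          using g f by (auto simp: fun_eq_iff restrict_def PiE_def extensional_def)
        ultimately show "g \<in> (\<lambda>f. restrict f (B - S)) ` annihilator S" by blast
      qed
    qed (auto split: if_splits)
  qed
  then have "card (annihilator S) = CARD('a) ^ card (B - S)"
    using bij_betw_same_card finB by (fastforce simp: card_funcsetE)
  moreover have "card S + card (B - S) = card B"
    using SB finB by (metis card_Diff_subset card_mono finite_subset le_add_diff_inverse)
  moreover have "dim UNIV = card B" using dim_eq_card[of B UNIV] B spanB by simp
  ultimately show ?thesis by (simp flip: power_add)
qed

lemma finite_annihilator:
  assumes "finite (UNIV :: 'b set)" and "finite (UNIV :: 'a set)"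
  shows "finite (annihilator S)"
  by (rule finite_subset[OF subset_UNIV]) (simp add: finite_UNIV_fun assms)

end

text \<open>Either h + t \<le> k, and \<open>q ^ h\<close> is at most both numbers subtracted from
  it, or h + t \<ge> k + 1, and it is at least both. Real division allows for k < t.\<close>

lemma off_consecutive_powers_nonneg:
  fixes q :: real
  assumes "q \<ge> 1"
  shows "(q ^ h - q ^ k / q ^ t) * (q ^ h - q * q ^ k / q ^ t) \<ge> 0"
proof -
  have q: "q > 0" using assms by simp
  show ?thesis
  proof (cases "h + t \<le> k")
    case True
    then have "q ^ (h + t) \<le> q ^ k" using assms by (rule power_increasing)
    then have "q ^ h \<le> q ^ k / q ^ t" using q by (simp add: pos_le_divide_eq power_add)
    moreover have "q ^ k / q ^ t \<le> q * q ^ k / q ^ t"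
      using assms q by (simp add: divide_le_cancel)
    ultimately show ?thesis by (intro mult_nonpos_nonpos) auto
  next
    case False
    then have "q ^ Suc k \<le> q ^ (h + t)" using assms by (intro power_increasing) auto
    then have "q * q ^ k / q ^ t \<le> q ^ h" using q by (simp add: pos_divide_le_eq power_add)
    moreover have "q ^ k / q ^ t \<le> q * q ^ k / q ^ t"
      using assms q by (simp add: divide_le_cancel)
    ultimately show ?thesis by (intro mult_nonneg_nonneg) auto
  qed
qed

lemma restrict_scalars_apply: "restrict_scalars \<phi> scale c v = scale (\<phi> c) v"
  by (simp add: restrict_scalars_def)

section \<open>Scattered subspaces for a subfield of the scalars\<close>

locale finite_scalar_extension = vector_space scale
  for scale :: "'f::field \<Rightarrow> 'v::ab_group_add \<Rightarrow> 'v" (infixr \<open>*s\<close> 75) +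
  fixes \<phi> :: "'k::field \<Rightarrow> 'f"
  assumes embedding: "field_embedding \<phi>"
    and finite_scalars: "finite (UNIV :: 'f set)"
begin

lemma embedding_add: "\<phi> (x + y) = \<phi> x + \<phi> y"
  and embedding_mult: "\<phi> (x * y) = \<phi> x * \<phi> y"
  and embedding_one: "\<phi> 1 = 1"
  using embedding by (auto simp: field_embedding_def)

lemma embedding_zero: "\<phi> 0 = 0"
  using embedding_add[of 0 0] by (metis add_cancel_right_right)

lemma inj_embedding: "inj \<phi>"
proof (rule injI, rule ccontr)
  fix x y assume eq: "\<phi> x = \<phi> y" and "x \<noteq> y"
  then have "1 = \<phi> ((x - y) * inverse (x - y))" by (simp add: embedding_one)
  also have "\<dots> = 0" using embedding_add[of "x - y" y] eq by (simp add: embedding_mult)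
  finally show False by simp
qed

lemma finite_small_scalars: "finite (UNIV :: 'k set)"
  using finite_imageD[OF finite_subset[OF subset_UNIV finite_scalars] inj_embedding] .

sublocale small: vector_space "restrict_scalars \<phi> scale"
  by unfold_locales
    (simp_all add: restrict_scalars_def scale_right_distrib scale_left_distrib
      embedding_add embedding_mult embedding_one)

lemma small_subspace: "subspace S \<Longrightarrow> small.subspace S"
  by (simp add: subspace_def small.subspace_def restrict_scalars_apply)

lemma small_span_singleton: "small.span {u} = range (\<lambda>c. \<phi> c *s u)"
  unfolding small.span_singleton restrict_scalars_apply ..

lemma card_small_line: "u \<noteq> 0 \<Longrightarrow> card (range (\<lambda>c. \<phi> c *s u)) = CARD('k)"
  using inj_embedding by (intro card_image) (auto simp: inj_on_def)

lemma small_dim_line: "u \<noteq> 0 \<Longrightarrow> small.dim (range (\<lambda>c. \<phi> c *s u)) = 1"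
  unfolding small_span_singleton[symmetric]
  by (subst small.dim_span_eq_card_independent) auto

text \<open>Weight one without dimensions: two nonzero vectors of \<open>U\<close> on the same
  projective point differ by a factor from the small field. The equivalence is
  \<open>scattered_linear_set_iff\<close>.\<close>

definition scattered :: "'v set \<Rightarrow> bool" where
  "scattered U \<longleftrightarrow> (\<forall>u\<in>U. \<forall>c. u \<noteq> 0 \<longrightarrow> c *s u \<in> U \<longrightarrow> c \<in> range \<phi>)"

text \<open>The intersection always contains the small line through \<open>u\<close>. If its
  dimension is one, both sets have \<open>CARD('k)\<close> elements and so coincide.\<close>

lemma Int_span_eq_small_line_iff:
  assumes "small.subspace U" and "u \<in> U" and "u \<noteq> 0"
  shows "small.dim (U \<inter> span {u}) = 1 \<longleftrightarrow> U \<inter> span {u} = range (\<lambda>c. \<phi> c *s u)"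
proof
  have fin: "finite (U \<inter> span {u})"
    using finite_span[OF finite_scalars, of "{u}"] assms(3) by simp
  have sub: "range (\<lambda>c. \<phi> c *s u) \<subseteq> U \<inter> span {u}"
    using small.subspace_scale[OF assms(1,2)]
    by (auto simp: restrict_scalars_apply intro: span_scale span_base)
  assume "small.dim (U \<inter> span {u}) = 1"
  then have "card (U \<inter> span {u}) = CARD('k)"
    using small.card_subspace[OF small.subspace_inter[OF assms(1) small_subspace[OF subspace_span]] fin]
    by simp
  then show "U \<inter> span {u} = range (\<lambda>c. \<phi> c *s u)"
    using card_subset_eq[OF fin sub] card_small_line[OF assms(3)] by simp
qed (simp add: small_dim_line[OF assms(3)])

lemma scattered_linear_set_iff:
  "scattered_linear_set \<phi> scale V U \<longleftrightarrow> small.subspace U \<and> U \<subseteq> V \<and> scattered U"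
proof -
  have "(\<forall>P\<in>linear_set scale U. point_weight \<phi> scale U P = 1) \<longleftrightarrow> scattered U"
    if U: "small.subspace U"
  proof -
    have "(\<forall>P\<in>linear_set scale U. point_weight \<phi> scale U P = 1) \<longleftrightarrow>
        (\<forall>u\<in>U. u \<noteq> 0 \<longrightarrow> small.dim (U \<inter> span {u}) = 1)"
      by (auto simp: linear_set_def point_weight_def)
    also have "\<dots> \<longleftrightarrow> (\<forall>u\<in>U. u \<noteq> 0 \<longrightarrow> U \<inter> span {u} = range (\<lambda>c. \<phi> c *s u))"
      using Int_span_eq_small_line_iff[OF U] by blast
    also have "\<dots> \<longleftrightarrow> scattered U"
    proof -
      have "U \<inter> span {u} = range (\<lambda>c. \<phi> c *s u) \<longleftrightarrow> (\<forall>c. c *s u \<in> U \<longrightarrow> c \<in> range \<phi>)"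
        if u: "u \<in> U" "u \<noteq> 0" for u
      proof
        assume eq: "U \<inter> span {u} = range (\<lambda>c. \<phi> c *s u)"
        show "\<forall>c. c *s u \<in> U \<longrightarrow> c \<in> range \<phi>"
        proof (intro allI impI)
          fix c assume "c *s u \<in> U"
          then have "c *s u \<in> range (\<lambda>c. \<phi> c *s u)"
            unfolding eq[symmetric] by (simp add: span_scale span_base)
          then show "c \<in> range \<phi>" using u(2) by auto
        qed
      next
        assume R: "\<forall>c. c *s u \<in> U \<longrightarrow> c \<in> range \<phi>"
        show "U \<inter> span {u} = range (\<lambda>c. \<phi> c *s u)"
          using R small.subspace_scale[OF U u(1)]
          by (auto simp: span_singleton restrict_scalars_apply)
      qed
      then show ?thesis by (auto simp: scattered_def)
    qed
    finally show ?thesis .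
  qed
  then show ?thesis by (auto simp: scattered_linear_set_def)
qed

text \<open>The dual of a finite space has as many elements as the space, so \<open>CARD('v)\<close>
  stands for the number of functionals, and each independent condition divides it by
  \<open>CARD('f)\<close>.\<close>

lemma real_card_annihilator:
  assumes "finite (UNIV :: 'v set)" and "independent S"
  shows "real (card (annihilator S)) = real (CARD('v)) / real (CARD('f)) ^ card S"
proof -
  have "CARD('f) ^ card S * card (annihilator S) = CARD('v)"
    using card_annihilator[OF assms] card_subspace[OF subspace_UNIV assms(1)] by simp
  then have "real (CARD('f)) ^ card S * real (card (annihilator S)) = real (CARD('v))"
    by (metis of_nat_mult of_nat_power)
  moreover have "real (CARD('f)) ^ card S \<noteq> 0" using finite_scalars by simp
  ultimately show ?thesis by (simp add: field_simps)
qed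

section \<open>Moments of the number of zeros in \<open>U\<close> of a functional, and the rank
  bound\<close>

context
  fixes U :: "'v set"
  assumes finite_space: "finite (UNIV :: 'v set)"
    and subspace_U: "small.subspace U"
    and scattered_U: "scattered U"
begin

lemma zero_in_U: "0 \<in> U"
  using subspace_U by (rule small.subspace_0)

lemma card_annihilator_point:
  "real (card (annihilator {u})) = (if u = 0 then CARD('v) else CARD('v) / CARD('f))"
proof (cases "u = 0")
  case True
  have "annihilator {0} = annihilator {}"
    using annihilator_span[of "{0}"] annihilator_span[of "{}"] by simp
  then show ?thesis using True real_card_annihilator[OF finite_space independent_empty] by simp
next
  case False
  then show ?thesis using real_card_annihilator[OF finite_space, of "{u}"] by simp
qed

lemma sum_card_annihilator_point:
  "(\<Sum>u\<in>U. real (card (annihilator {u}))) = CARD('v) * (1 + (real (card U) - 1) / CARD('f))"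
proof -
  have fin: "finite U" using finite_subset[OF subset_UNIV finite_space] .
  have "(\<Sum>u\<in>U. real (card (annihilator {u}))) = CARD('v) + (\<Sum>u\<in>U - {0}. real (card (annihilator {u})))"
    using fin zero_in_U by (subst sum.remove[of _ 0]) (auto simp: card_annihilator_point)
  also have "(\<Sum>u\<in>U - {0}. real (card (annihilator {u}))) =
      (real (card U) - 1) * (CARD('v) / CARD('f))"
    using fin zero_in_U card_gt_0_iff[of U]
    by (auto simp: card_annihilator_point card_Diff_singleton of_nat_diff)
  finally show ?thesis by (simp add: field_simps)
qed

text \<open>Double counting of the pairs (f, u) with f u = 0.\<close>

lemma sum_zeros_eq:
  "(\<Sum>f\<in>annihilator {}. real (card {u\<in>U. f u = 0})) =
    CARD('v) * (1 + (real (card U) - 1) / CARD('f))"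
proof -
  have fin: "finite U" using finite_subset[OF subset_UNIV finite_space] .
  have "(\<Sum>f\<in>annihilator {}. real (card {u\<in>U. f u = 0})) =
      (\<Sum>f\<in>annihilator {}. \<Sum>u\<in>U. of_bool (f u = 0))"
    using fin by (simp add: Int_def)
  also have "\<dots> = (\<Sum>u\<in>U. \<Sum>f\<in>annihilator {}. of_bool (f u = 0))"
    by (rule sum.swap)
  also have "\<dots> = (\<Sum>u\<in>U. real (card (annihilator {u})))"
    using finite_annihilator[OF finite_space finite_scalars]
    by (intro sum.cong refl) (simp add: annihilator_eq[of "{_}"] Int_def)
  also have "\<dots> = CARD('v) * (1 + (real (card U) - 1) / CARD('f))"
    by (rule sum_card_annihilator_point)
  finally show ?thesis .
qed

text \<open>If \<open>v\<close> is a multiple of \<open>u\<close>, it imposes no further condition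
  on a functional vanishing at \<open>u\<close>; otherwise the two conditions are
  independent.\<close>

lemma card_annihilator_pair:
  assumes "u \<noteq> 0"
  shows "real (card (annihilator {u, v})) =
    (if v \<in> span {u} then CARD('v) / CARD('f) else CARD('v) / real (CARD('f)) ^ 2)"
proof (cases "v \<in> span {u}")
  case True
  then have "span {u, v} = span {u}" by (metis insert_commute span_redundant)
  then have "annihilator {u, v} = annihilator {u}" by (metis annihilator_span)
  then show ?thesis using True assms by (simp add: card_annihilator_point)
next
  case False
  then have "v \<noteq> u" and "independent {v, u}"
    using assms by (auto simp: independent_insert span_base)
  then show ?thesis
    using False real_card_annihilator[OF finite_space, of "{v, u}"]
    by (simp add: insert_commute power2_eq_square)
qed

text \<open>The square counts triples (f, u, v) with f u = f v = 0. The case u = 0 gives the first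
  moment again; for u \<noteq> 0 one needs to know how many v in \<open>U\<close> are multiples of
  u.\<close>

lemma sum_zeros_sq_eq:
  "(\<Sum>f\<in>annihilator {}. (real (card {u\<in>U. f u = 0}))\<^sup>2) =
    CARD('v) * (1 + (real (card U) - 1) / CARD('f) +
      (real (card U) - 1) * (real CARD('k) / CARD('f) +
        (real (card U) - CARD('k)) / (real CARD('f))\<^sup>2))"
proof -
  have fin: "finite U" using finite_subset[OF subset_UNIV finite_space] .
  have "(\<Sum>f\<in>annihilator {}. (real (card {u\<in>U. f u = 0}))\<^sup>2) =
      (\<Sum>f\<in>annihilator {}. (\<Sum>u\<in>U. of_bool (f u = 0)) * (\<Sum>v\<in>U. of_bool (f v = 0)))"
    using fin by (simp add: Int_def power2_eq_square)
  also have "\<dots> = (\<Sum>f\<in>annihilator {}. \<Sum>u\<in>U. \<Sum>v\<in>U. of_bool (f u = 0 \<and> f v = 0))"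
    by (simp add: sum_product of_bool_conj)
  also have "\<dots> = (\<Sum>u\<in>U. \<Sum>v\<in>U. \<Sum>f\<in>annihilator {}. of_bool (f u = 0 \<and> f v = 0))"
    by (subst sum.swap) (intro sum.cong refl sum.swap)
  also have "\<dots> = (\<Sum>u\<in>U. \<Sum>v\<in>U. real (card (annihilator {u, v})))"
    using finite_annihilator[OF finite_space finite_scalars]
    by (intro sum.cong refl) (simp add: annihilator_eq[of "{_, _}"] Int_def)
  also have "\<dots> = (\<Sum>v\<in>U. real (card (annihilator {0, v}))) +
      (\<Sum>u\<in>U - {0}. \<Sum>v\<in>U. real (card (annihilator {u, v})))"
    using fin zero_in_U by (rule sum.remove)
  also have "(\<Sum>v\<in>U. real (card (annihilator {0, v}))) =
      CARD('v) * (1 + (real (card U) - 1) / CARD('f))"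
  proof -
    have "annihilator {0, v} = annihilator {v}" for v
      using annihilator_span[of "{0, v}"] annihilator_span[of "{v}"] by simp
    then show ?thesis by (simp only: sum_card_annihilator_point)
  qed
  also have "(\<Sum>u\<in>U - {0}. \<Sum>v\<in>U. real (card (annihilator {u, v}))) =
      (\<Sum>u\<in>U - {0}. CARD('v) * (real CARD('k) / CARD('f) +
        (real (card U) - CARD('k)) / (real CARD('f))\<^sup>2))"
  proof (intro sum.cong refl)
    fix u assume u: "u \<in> U - {0}"
    define L where "L = range (\<lambda>c. \<phi> c *s u)"
    \<comment> \<open>The only use of scatteredness in the rank bound: exactly
      \<open>CARD('k)\<close> vectors of \<open>U\<close> are multiples of \<open>u\<close> over the
      large field.\<close>
    have L: "U \<inter> span {u} = L"
      using u scattered_U small.subspace_scale[OF subspace_U, of u]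
      by (auto simp: L_def scattered_def span_singleton restrict_scalars_apply)
    have cL: "card L = CARD('k)" unfolding L_def using u card_small_line by simp
    have "(\<Sum>v\<in>U. real (card (annihilator {u, v}))) =
        (\<Sum>v\<in>U - L. real (card (annihilator {u, v}))) + (\<Sum>v\<in>L. real (card (annihilator {u, v})))"
      using L fin by (intro sum.subset_diff) auto
    also have "(\<Sum>v\<in>U - L. real (card (annihilator {u, v}))) =
        (\<Sum>v\<in>U - L. CARD('v) / real (CARD('f)) ^ 2)"
      using u L by (intro sum.cong refl) (auto simp: card_annihilator_pair)
    also have "\<dots> = (real (card U) - CARD('k)) * (CARD('v) / real (CARD('f)) ^ 2)"
    proof -
      have "L \<subseteq> U" using L by auto
      then have "real (card (U - L)) = real (card U) - CARD('k)"
        using fin cL by (metis card_Diff_subset card_mono finite_subset of_nat_diff)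
      then show ?thesis by simp
    qed
    also have "(\<Sum>v\<in>L. real (card (annihilator {u, v}))) = (\<Sum>v\<in>L. CARD('v) / CARD('f))"
      using u L by (intro sum.cong refl) (auto simp: card_annihilator_pair)
    also have "\<dots> = real (CARD('k)) * (CARD('v) / CARD('f))" using cL by simp
    finally show "(\<Sum>v\<in>U. real (card (annihilator {u, v}))) =
        CARD('v) * (real CARD('k) / CARD('f) + (real (card U) - CARD('k)) / (real CARD('f))\<^sup>2)"
      by (simp add: algebra_simps)
  qed
  also have "\<dots> = (real (card U) - 1) * (CARD('v) * (real CARD('k) / CARD('f) +
        (real (card U) - CARD('k)) / (real CARD('f))\<^sup>2))"
    using fin zero_in_U card_gt_0_iff[of U] by (auto simp: card_Diff_singleton of_nat_diff)
  finally show ?thesis by (simp add: algebra_simps)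
qed

text \<open>The subspace \<open>X\<close> is kept apart from the ambient space so that each summand
  can be treated with functionals on the whole space.\<close>

lemma scattered_rank_bound:
  assumes cf: "CARD('f) = CARD('k) ^ t" and t: "t \<ge> 2"
    and X: "subspace X" and UX: "U \<subseteq> X"
  shows "2 * small.dim U \<le> dim X * t"
proof -
  define q Q K N where "q = real CARD('k)" and "Q = real CARD('f)"
    and "K = real (card U)" and "N = real CARD('v)"
  define x where "x f = real (card {u\<in>U. f u = 0})" for f :: "'v \<Rightarrow> 'f"
  define A :: "('v \<Rightarrow> 'f) set" where "A = annihilator {}"
  have fin: "finite S" for S :: "'v set" using finite_subset[OF subset_UNIV finite_space] .
  have finA: "finite A" unfolding A_def by (rule finite_annihilator[OF finite_space finite_scalars])
  have "card {0, 1 :: 'k} \<le> CARD('k)" using finite_small_scalars by (intro card_mono) auto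
  then have q: "q \<ge> 2" by (simp add: q_def)
  have Qq: "Q = q ^ t" by (simp add: Q_def q_def cf)
  \<comment> \<open>Here t \<ge> 2 enters: it makes 1 - q / Q strictly positive, and that factor is
    cancelled at the end.\<close>
  have "q ^ 1 < q ^ t" using q t by (intro power_strict_increasing) auto
  then have qQ: "q < Q" by (simp add: Qq)
  then have Q: "Q > 1" using q by simp
  have N: "N > 0" using finite_space by (simp add: N_def card_gt_0_iff)
  have K: "K = q ^ small.dim U"
    using small.card_subspace[OF subspace_U fin] by (simp add: K_def q_def)
  \<comment> \<open>The roots are the consecutive powers of \<open>q\<close> with exponents k - t
    and k - t + 1, where k is the rank of \<open>U\<close>.\<close>
  define g where "g f = (x f - K / Q) * (x f - q * K / Q)" for f
  have g_nonneg: "g f \<ge> 0" if "f \<in> A" for f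
  proof -
    interpret f: Vector_Spaces.linear scale "(*) :: 'f \<Rightarrow> 'f \<Rightarrow> 'f" f
      using that by (simp add: A_def annihilator_def)
    have "small.subspace {u\<in>U. f u = 0}"
      using subspace_U
      by (auto simp: small.subspace_def restrict_scalars_apply f.add f.scale f.zero)
    then have "x f = q ^ small.dim {u\<in>U. f u = 0}"
      using small.card_subspace[OF _ fin] by (simp add: x_def q_def)
    then show ?thesis
      unfolding g_def K Qq using off_consecutive_powers_nonneg[of q] q by simp
  qed
  have "(\<Sum>f\<in>A. g f) = (\<Sum>f\<in>A. (x f)\<^sup>2 - ((q + 1) * K / Q) * x f + q * K\<^sup>2 / Q\<^sup>2)"
    using Q by (intro sum.cong refl) (simp add: g_def field_simps power2_eq_square)
  also have "\<dots> = (\<Sum>f\<in>A. (x f)\<^sup>2) - ((q + 1) * K / Q) * (\<Sum>f\<in>A. x f) + card A * (q * K\<^sup>2 / Q\<^sup>2)"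
    by (simp add: sum.distrib sum_subtractf sum_distrib_left)
  also have "card A = N"
    using real_card_annihilator[OF finite_space independent_empty] by (simp add: A_def N_def)
  also have "(\<Sum>f\<in>A. x f) = N * (1 + (K - 1) / Q)"
    unfolding A_def x_def K_def Q_def N_def by (rule sum_zeros_eq)
  also have "(\<Sum>f\<in>A. (x f)\<^sup>2) = N * (1 + (K - 1) / Q + (K - 1) * (q / Q + (K - q) / Q\<^sup>2))"
    unfolding A_def x_def K_def Q_def N_def q_def by (rule sum_zeros_sq_eq)
  \<comment> \<open>The terms in \<open>K\<close> and in its square cancel; what remains is 1 - 1/Q
    - q/Q + q/Q^2, which factors.\<close>
  also have "N * (1 + (K - 1) / Q + (K - 1) * (q / Q + (K - q) / Q\<^sup>2)) -
      ((q + 1) * K / Q) * (N * (1 + (K - 1) / Q)) + N * (q * K\<^sup>2 / Q\<^sup>2) =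
      N * ((1 - 1 / Q) * (1 - q / Q))"
    using Q by (simp add: field_simps power2_eq_square)
  finally have total: "(\<Sum>f\<in>A. g f) = N * ((1 - 1 / Q) * (1 - q / Q))" .
  obtain B where B: "B \<subseteq> X" "independent B" "X \<subseteq> span B" "card B = dim X"
    by (rule basis_exists)
  \<comment> \<open>The counting lemma wants an independent set, so \<open>X\<close> is replaced by
    a basis.\<close>
  have "annihilator X = annihilator B"
    using B X by (metis annihilator_span span_subspace)
  then have cX: "real (card (annihilator X)) = N / Q ^ dim X"
    using real_card_annihilator[OF finite_space B(2)] B(4) by (simp add: N_def Q_def)
  \<comment> \<open>Since \<open>U\<close> lies in \<open>X\<close>, these functionals vanish on all
    of \<open>U\<close> and attain the largest possible value of \<open>x\<close>.\<close>
  have "x f = K" if "f \<in> annihilator X" for f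
  proof -
    have "{u\<in>U. f u = 0} = U" using that UX by (auto simp: annihilator_def)
    then show ?thesis by (simp add: x_def K_def)
  qed
  then have "g f = K\<^sup>2 * ((1 - 1 / Q) * (1 - q / Q))" if "f \<in> annihilator X" for f
    using that Q by (simp add: g_def field_simps power2_eq_square)
  then have "(\<Sum>f\<in>annihilator X. g f) = N / Q ^ dim X * (K\<^sup>2 * ((1 - 1 / Q) * (1 - q / Q)))"
    by (simp add: cX)
  moreover have "(\<Sum>f\<in>annihilator X. g f) \<le> (\<Sum>f\<in>A. g f)"
    using finA g_nonneg by (intro sum_mono2) (auto simp: A_def annihilator_def)
  \<comment> \<open>Both sides are arranged with the same outer factors, the right one with an
    explicit 1, so that cancellation leaves the bound on \<open>K\<close>.\<close>
  ultimately have le: "N * (K\<^sup>2 / Q ^ dim X) * ((1 - 1 / Q) * (1 - q / Q)) \<le>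
      N * 1 * ((1 - 1 / Q) * (1 - q / Q))"
    using total by (simp add: field_simps)
  have "(1 - 1 / Q) * (1 - q / Q) > 0" using Q qQ by simp
  then have "K\<^sup>2 / Q ^ dim X \<le> 1" using le N by (simp only: mult_le_cancel_right_pos mult_le_cancel_left_pos)
  then have "K\<^sup>2 \<le> Q ^ dim X" using Q by (simp add: pos_divide_le_eq)
  then have "q ^ (small.dim U * 2) \<le> q ^ (t * dim X)"
    by (simp only: K Qq power_mult)
  then have "small.dim U * 2 \<le> t * dim X" using q by (simp add: power_increasing_iff)
  then show ?thesis by (simp add: mult.commute)
qed

end

end

section \<open>Internal direct sums\<close>

lemma internal_direct_sum_card:
  assumes "finite I" and "internal_direct_sum I A S"
  shows "card S = (\<Prod>i\<in>I. card (A i))"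
  using bij_betw_same_card[OF assms(2)[unfolded internal_direct_sum_def]] assms(1)
  by (simp add: card_PiE)

lemma internal_direct_sum_finite:
  assumes "finite I" and "internal_direct_sum I A S" and "\<And>i. i \<in> I \<Longrightarrow> finite (A i)"
  shows "finite S"
  using bij_betw_finite[OF assms(2)[unfolded internal_direct_sum_def]] assms(1,3)
  by (simp add: finite_PiE)

text \<open>Injectivity is available for extensional families only, so arbitrary families are first
  restricted to \<open>I\<close>.\<close>

lemma internal_direct_sum_unique:
  assumes "internal_direct_sum I A S"
    and "\<And>i. i \<in> I \<Longrightarrow> a i \<in> A i" and "\<And>i. i \<in> I \<Longrightarrow> b i \<in> A i"
    and "(\<Sum>i\<in>I. a i) = (\<Sum>i\<in>I. b i)" and "i \<in> I"
  shows "a i = b i"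
proof -
  have "restrict a I = restrict b I"
    using assms(2-4) bij_betw_imp_inj_on[OF assms(1)[unfolded internal_direct_sum_def]]
    by (auto elim!: inj_onD)
  then show ?thesis using assms(5) by (metis restrict_apply')
qed

lemma internal_direct_sum_image:
  assumes "internal_direct_sum I A S"
  shows "S = {\<Sum>i\<in>I. a i | a. \<forall>i\<in>I. a i \<in> A i}"
proof -
  have "S = (\<lambda>a. \<Sum>i\<in>I. a i) ` Pi\<^sub>E I A"
    using assms by (simp add: internal_direct_sum_def bij_betw_def)
  also have "\<dots> = {\<Sum>i\<in>I. a i | a. \<forall>i\<in>I. a i \<in> A i}"
  proof (intro equalityI subsetI)
    fix x assume "x \<in> {\<Sum>i\<in>I. a i | a. \<forall>i\<in>I. a i \<in> A i}"
    then obtain a where a: "x = (\<Sum>i\<in>I. a i)" "\<forall>i\<in>I. a i \<in> A i" by blast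
    then have "x = (\<Sum>i\<in>I. restrict a I i)" "restrict a I \<in> Pi\<^sub>E I A" by auto
    then show "x \<in> (\<lambda>a. \<Sum>i\<in>I. a i) ` Pi\<^sub>E I A" by (rule image_eqI[of _ _ "restrict a I"])
  qed auto
  finally show ?thesis .
qed

context vector_space
begin

lemma subspace_internal_direct_sum:
  assumes "internal_direct_sum I A S" and A: "\<And>i. i \<in> I \<Longrightarrow> subspace (A i)"
  shows "subspace S"
  unfolding subspace_def
proof (intro conjI ballI allI)
  note S = internal_direct_sum_image[OF assms(1)]
  show "0 \<in> S"
    unfolding S using subspace_0[OF A] by (auto intro!: exI[of _ "\<lambda>_. 0"])
  fix x assume "x \<in> S"
  then obtain a where a: "x = (\<Sum>i\<in>I. a i)" "\<forall>i\<in>I. a i \<in> A i" unfolding S by blast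
  show "c *s x \<in> S" for c
    unfolding S using a subspace_scale[OF A]
    by (auto intro!: exI[of _ "\<lambda>i. c *s a i"] simp: scale_sum_right)
  fix y assume "y \<in> S"
  then obtain b where b: "y = (\<Sum>i\<in>I. b i)" "\<forall>i\<in>I. b i \<in> A i" unfolding S by blast
  show "x + y \<in> S"
    unfolding S using a b subspace_add[OF A]
    by (auto intro!: exI[of _ "\<lambda>i. a i + b i"] simp: sum.distrib)
qed

text \<open>Cardinalities multiply along the sum; as \<open>CARD('a)\<close> exceeds 1, exponents
  can be compared, and dimensions add.\<close>

lemma dim_internal_direct_sum:
  assumes I: "finite I" and sum: "internal_direct_sum I A S"
    and A: "\<And>i. i \<in> I \<Longrightarrow> subspace (A i)" and fin: "\<And>i. i \<in> I \<Longrightarrow> finite (A i)"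
    and scalars: "finite (UNIV :: 'a set)"
  shows "dim S = (\<Sum>i\<in>I. dim (A i))"
proof -
  have "card {0, 1 :: 'a} \<le> CARD('a)" using scalars by (intro card_mono) auto
  then have q: "CARD('a) > 1" by simp
  have "CARD('a) ^ dim S = card S"
    using card_subspace[OF subspace_internal_direct_sum[OF sum A]]
      internal_direct_sum_finite[OF I sum fin] by simp
  also have "\<dots> = (\<Prod>i\<in>I. CARD('a) ^ dim (A i))"
    unfolding internal_direct_sum_card[OF I sum]
    by (intro prod.cong refl card_subspace A fin)
  also have "\<dots> = CARD('a) ^ (\<Sum>i\<in>I. dim (A i))" by (simp add: power_sum)
  finally show ?thesis using q by (simp add: power_inject_exp)
qed

end

lemma (in finite_scalar_extension) scattered_internal_direct_sum:
  assumes V: "\<And>i. i \<in> I \<Longrightarrow> subspace (V i)" and sumV: "internal_direct_sum I V S"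
    and UV: "\<And>i. i \<in> I \<Longrightarrow> U i \<subseteq> V i" and U: "\<And>i. i \<in> I \<Longrightarrow> scattered (U i)"
    and sumU: "internal_direct_sum I U W"
  shows "scattered W"
  unfolding scattered_def
proof (intro ballI allI impI)
  note W = internal_direct_sum_image[OF sumU]
  fix w c assume "w \<in> W" "w \<noteq> 0" "c *s w \<in> W"
  then obtain a b where a: "w = (\<Sum>i\<in>I. a i)" "\<forall>i\<in>I. a i \<in> U i"
    and b: "c *s w = (\<Sum>i\<in>I. b i)" "\<forall>i\<in>I. b i \<in> U i" unfolding W by blast
  from a \<open>w \<noteq> 0\<close> obtain i where i: "i \<in> I" "a i \<noteq> 0" by (metis sum.neutral)
  \<comment> \<open>Uniqueness is applied in the sum of the \<open>V j\<close>: these are closed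
    under the large field, whereas \<open>c *s a j\<close> is not yet known to lie in
    \<open>U j\<close>.\<close>
  have "c *s a i = b i"
  proof (rule internal_direct_sum_unique[OF sumV _ _ _ i(1)])
    show "c *s a j \<in> V j" if "j \<in> I" for j
      using that a(2) UV subspace_scale[OF V] by blast
    show "b j \<in> V j" if "j \<in> I" for j using that b(2) UV by blast
    show "(\<Sum>i\<in>I. c *s a i) = (\<Sum>i\<in>I. b i)" using a(1) b(1) by (simp add: scale_sum_right)
  qed
  then show "c \<in> range \<phi>" using U[OF i(1)] a(2) b(2) i unfolding scattered_def by metis
qed

text \<open>The equivalence is confined to t \<ge> 2 because for t = 1 every subspace is scattered:
  two planes with U 1 = V 1 and U 2 = {0} give \<open>W\<close> half the total dimension, but
  neither summand has half of its own.\<close>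

theorem theorem3p1:
  fixes q t r m :: nat
    and \<phi> :: "'k::field \<Rightarrow> 'f::field"
    and scale :: "'f \<Rightarrow> 'v::ab_group_add \<Rightarrow> 'v"
    and V U :: "nat \<Rightarrow> 'v set"
    and s :: "nat \<Rightarrow> nat"
    and W :: "'v set"
  assumes "primepow q" and "t > 0"
    and "CARD('k) = q" and "CARD('f) = q ^ t" and "field_embedding \<phi>"
    and "vector_space scale" and "vector_space.dim scale (UNIV :: 'v set) = r"
    and "\<And>i. i \<in> {1..m} \<Longrightarrow> module.subspace scale (V i)"
    and "internal_direct_sum {1..m} V UNIV"
    and "\<And>i. i \<in> {1..m} \<Longrightarrow> vector_space.dim scale (V i) = s i"
    and "\<And>i. i \<in> {1..m} \<Longrightarrow> s i \<ge> 2"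
    and "\<And>i. i \<in> {1..m} \<Longrightarrow> scattered_linear_set \<phi> scale (V i) (U i)"
    and "internal_direct_sum {1..m} U W"
  shows "scattered_linear_set \<phi> scale UNIV W \<and>
    (t \<ge> 2 \<longrightarrow>
      (real (linear_set_rank \<phi> scale W) = real (r * t) / 2 \<longleftrightarrow>
       (\<forall>i\<in>{1..m}. real (linear_set_rank \<phi> scale (U i)) = real (s i * t) / 2)))"
proof -
  \<comment> \<open>\<open>CARD\<close> of an infinite type is 0, so positivity amounts to
    finiteness of the large field.\<close>
  have card_pos: "CARD('f) > 0"
    using assms(1,4) primepow_gt_0_nat by simp
  interpret finite_scalar_extension scale \<phi>
    using assms(5,6) card_pos
    by (simp add: finite_scalar_extension_def finite_scalar_extension_axioms_def card_gt_0_iff)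
  let ?I = "{1..m}"
  have V: "subspace (V i)" and V_finite: "finite (V i)" and V_dim: "dim (V i) = s i"
    if "i \<in> ?I" for i
    using assms(8,10,11)[OF that] finite_subspace_of_dim_pos[OF finite_scalars, of "V i"] by auto
  have U: "small.subspace (U i)" "U i \<subseteq> V i" "scattered (U i)" if "i \<in> ?I" for i
    using assms(12)[OF that] by (simp_all add: scattered_linear_set_iff)
  \<comment> \<open>Finiteness of the ambient space is derived from the summands: each has positive
    dimension over a finite field.\<close>
  have finite_V: "finite (UNIV :: 'v set)"
    using internal_direct_sum_finite[OF _ assms(9)] V_finite by simp
  have "scattered_linear_set \<phi> scale UNIV W"
    unfolding scattered_linear_set_iff
    using small.subspace_internal_direct_sum[OF assms(13) U(1)]
      scattered_internal_direct_sum[OF V assms(9) U(2,3) assms(13)] by simp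
  moreover have "real (linear_set_rank \<phi> scale W) = real (r * t) / 2 \<longleftrightarrow>
      (\<forall>i\<in>?I. real (linear_set_rank \<phi> scale (U i)) = real (s i * t) / 2)" if t: "t \<ge> 2"
  proof -
    have half: "real a = real b / 2 \<longleftrightarrow> 2 * a = b" for a b :: nat by linarith
    have bound: "2 * small.dim (U i) \<le> s i * t" if "i \<in> ?I" for i
      using scattered_rank_bound[OF finite_V U(1,3) _ t V U(2), of i] that assms(3,4) V_dim by simp
    have "finite (U i)" for i using finite_subset[OF subset_UNIV finite_V] .
    then have rank: "small.dim W = (\<Sum>i\<in>?I. small.dim (U i))"
      using small.dim_internal_direct_sum[OF _ assms(13) U(1) _ finite_small_scalars] by simp
    have "r = (\<Sum>i\<in>?I. s i)"
      using dim_internal_direct_sum[OF _ assms(9) V V_finite finite_scalars] assms(7) V_dim by simp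
    then have "2 * small.dim W = r * t \<longleftrightarrow> (\<Sum>i\<in>?I. 2 * small.dim (U i)) = (\<Sum>i\<in>?I. s i * t)"
      by (simp add: rank sum_distrib_left sum_distrib_right)
    \<comment> \<open>By the rank bound each term on the left is at most its partner on the right,
      so equal sums force equality term by term.\<close>
    also have "\<dots> \<longleftrightarrow> (\<forall>i\<in>?I. 2 * small.dim (U i) = s i * t)"
      using sum_mono_inv[of "\<lambda>i. 2 * small.dim (U i)" ?I "\<lambda>i. s i * t"] bound
      by (auto intro: sum.cong)
    finally show ?thesis by (simp only: linear_set_rank_def half)
  qed
  ultimately show ?thesis by blast
qed

end
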